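(* Let $(\mathscr R,+,\cdot)$ be a normed unital commutative ring with norm $\|\cdot\|$ such that $(\mathscr R,+)$ is a dense subspace of a separable, reflexive Banach space $\mathscr B$ with norm $\|\cdot\|$. Let $d\in\mathbb N$ and let $H^2_{\mathscr B}$ be the completion of the polynomial space $\mathscr R[x]$, $x=(x_1,\dots,x_d)$, under the $\ell^2$ polynomial norm. Then $H^2_{\mathscr B}$ is locally sequentially weakly compact.
   Context: A normed ring here is a ring whose additive group is a (complex) vector space carrying a norm; submultiplicativity of the norm is not required. $\mathscr R[x]$ is the space of polynomials $\sum_{|k|\le K}\psi_k x^k$ with $K\in\mathbb N_0$, $\psi_k\in\mathscr R$, $k=(k_1,\dots,k_d)\in\mathbb N_0^d$, $|k|=\sum_j k_j$, $x^k=x_1^{k_1}\cdots x_d^{k_d}$. The $\ell^2$ polynomial norm is $\|\sum_k\psi_kx^k\|_{\mathscr R,2}=(\sum_{k\in\mathbb N_0^d}\|\psi_k\|^2)^{1/2}$. The completion is $$H^2_{\mathscr B}=\Big\{\sum_{k\in\mathbb N_0^d}\psi_kx^k : \psi_k\in\mathscr B,\ \sum_{k\in\mathbb N_0^d}\|\psi_k\|^2<\infty\Big\}$$ (formal series) with the same norm formula. A Banach space is locally sequentially weakly compact if every norm-bounded sequence has a subsequence converging weakly to an element of the space (equivalently, every closed ball is sequentially weakly compact). *)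

theory Defs
  imports "HOL-Analysis.Analysis" "HOL-Algebra.Ring"
begin

section \<open>Complex normed spaces, duals and weak convergence\<close>

class complex_normed_vector = real_normed_vector +
  fixes scaleC :: "complex \<Rightarrow> 'a \<Rightarrow> 'a" (infixr "*\<^sub>C" 75)
  assumes scaleC_add_right: "c *\<^sub>C (x + y) = c *\<^sub>C x + c *\<^sub>C y"
    and scaleC_add_left: "(b + c) *\<^sub>C x = b *\<^sub>C x + c *\<^sub>C x"
    and scaleC_scaleC: "b *\<^sub>C c *\<^sub>C x = (b * c) *\<^sub>C x"
    and scaleC_complex_of_real: "complex_of_real r *\<^sub>C x = r *\<^sub>R x"
    and norm_scaleC: "norm (c *\<^sub>C x) = cmod c * norm x"

class complex_banach = complex_normed_vector + complete_space
begin
subclass banach ..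
end

text \<open>The continuous complex-linear functionals; \<^const>\<open>bounded_linear\<close> is real linearity and
  boundedness. The dual norm is \<^const>\<open>onorm\<close>.\<close>

definition dual_space :: "('a::complex_normed_vector \<Rightarrow> complex) set" where
  "dual_space = {f. bounded_linear f \<and> (\<forall>c x. f (c *\<^sub>C x) = c * f x)}"

text \<open>Elements of the bidual are functions on \<^term>\<open>dual_space\<close>; their values outside that set
  are irrelevant.\<close>

definition bidual_space :: "(('a::complex_normed_vector \<Rightarrow> complex) \<Rightarrow> complex) set" where
  "bidual_space = {\<Phi>.
     (\<forall>f\<in>dual_space. \<forall>g\<in>dual_space. \<Phi> (\<lambda>x. f x + g x) = \<Phi> f + \<Phi> g) \<and>
     (\<forall>c. \<forall>f\<in>dual_space. \<Phi> (\<lambda>x. c * f x) = c * \<Phi> f) \<and>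
     (\<exists>K. \<forall>f\<in>dual_space. cmod (\<Phi> f) \<le> K * onorm f)}"

definition reflexive_space :: "'a::complex_normed_vector itself \<Rightarrow> bool" where
  "reflexive_space _ \<longleftrightarrow>
     (\<forall>\<Phi> \<in> bidual_space. \<exists>x::'a. \<forall>f\<in>dual_space. \<Phi> f = f x)"

definition weakly_converges_to :: "(nat \<Rightarrow> 'a::complex_normed_vector) \<Rightarrow> 'a \<Rightarrow> bool" where
  "weakly_converges_to X x \<longleftrightarrow> (\<forall>f\<in>dual_space. (\<lambda>n. f (X n)) \<longlonglongrightarrow> f x)"

definition locally_seq_weakly_compact :: "'a::complex_normed_vector itself \<Rightarrow> bool" where
  "locally_seq_weakly_compact _ \<longleftrightarrow>
     (\<forall>X :: nat \<Rightarrow> 'a. bounded (range X) \<longrightarrow>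
        (\<exists>x r. strict_mono r \<and> weakly_converges_to (X \<circ> r) x))"


section \<open>Normed rings\<close>

text \<open>A commutative unital ring whose additive group is a complex linear subspace of the ambient
  normed space. The multiplication is not assumed to be continuous, let alone submultiplicative,
  nor to be compatible with the scalar multiplication.\<close>

definition normed_comm_ring :: "('b::complex_normed_vector, 'm) ring_scheme \<Rightarrow> bool" where
  "normed_comm_ring R \<longleftrightarrow> cring R \<and>
     (\<forall>x\<in>carrier R. \<forall>y\<in>carrier R. x \<oplus>\<^bsub>R\<^esub> y = x + y) \<and>
     (\<forall>c. \<forall>x\<in>carrier R. c *\<^sub>C x \<in> carrier R)"

lemma normed_comm_ring_zero:
  assumes "normed_comm_ring R"
  shows "\<zero>\<^bsub>R\<^esub> = 0" and "0 \<in> carrier R"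
proof -
  interpret cring R using assms by (simp add: normed_comm_ring_def)
  have "\<zero>\<^bsub>R\<^esub> + \<zero>\<^bsub>R\<^esub> = \<zero>\<^bsub>R\<^esub>"
    using assms unfolding normed_comm_ring_def by (metis l_zero zero_closed)
  then show "\<zero>\<^bsub>R\<^esub> = 0" by simp
  then show "0 \<in> carrier R" using zero_closed by simp
qed


section \<open>Square-summable families\<close>

definition sq_summable :: "('k \<Rightarrow> 'b::real_normed_vector) \<Rightarrow> bool" where
  "sq_summable f \<longleftrightarrow> (\<lambda>k. (norm (f k))\<^sup>2) summable_on UNIV"

definition l2norm :: "('k \<Rightarrow> 'b::real_normed_vector) \<Rightarrow> real" where
  "l2norm f = sqrt (\<Sum>\<^sub>\<infinity>k. (norm (f k))\<^sup>2)"

lemma l2norm_nonneg: "0 \<le> l2norm f"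
  by (simp add: l2norm_def infsum_nonneg)

lemma L2_set_le_l2norm:
  assumes "sq_summable f" "finite F"
  shows "L2_set (\<lambda>k. norm (f k)) F \<le> l2norm f"
  using assms unfolding L2_set_def l2norm_def sq_summable_def
  by (intro real_sqrt_le_mono finite_sum_le_infsum) auto

lemma sq_summableI:
  assumes "\<And>F. finite F \<Longrightarrow> L2_set (\<lambda>k. norm (f k)) F \<le> B"
  shows "sq_summable f" and "l2norm f \<le> B"
proof -
  have B: "0 \<le> B" using assms[of "{}"] by simp
  have le: "(\<Sum>k\<in>F. (norm (f k))\<^sup>2) \<le> B\<^sup>2" if "finite F" for F
    using assms[OF that] unfolding L2_set_def by (simp add: real_le_rsqrt sqrt_le_D)
  show "sq_summable f" unfolding sq_summable_def
    by (rule nonneg_bdd_above_summable_on) (auto intro!: bdd_aboveI[where M = "B\<^sup>2"] le)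
  then have "(\<Sum>\<^sub>\<infinity>k. (norm (f k))\<^sup>2) \<le> B\<^sup>2"
    unfolding sq_summable_def by (rule infsum_le_finite_sums) (use le in auto)
  then show "l2norm f \<le> B"
    unfolding l2norm_def using B by (simp add: real_le_lsqrt infsum_nonneg)
qed

lemma sq_summable_add:
  assumes "sq_summable f" "sq_summable g"
  shows "sq_summable (\<lambda>k. f k + g k)" and "l2norm (\<lambda>k. f k + g k) \<le> l2norm f + l2norm g"
proof -
  have "L2_set (\<lambda>k. norm (f k + g k)) F \<le> l2norm f + l2norm g" if "finite F" for F
  proof -
    have "L2_set (\<lambda>k. norm (f k + g k)) F \<le> L2_set (\<lambda>k. norm (f k) + norm (g k)) F"
      by (intro L2_set_mono norm_triangle_ineq norm_ge_zero)
    also have "\<dots> \<le> L2_set (\<lambda>k. norm (f k)) F + L2_set (\<lambda>k. norm (g k)) F"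
      by (rule L2_set_triangle_ineq)
    also have "\<dots> \<le> l2norm f + l2norm g"
      using assms that by (intro add_mono L2_set_le_l2norm)
    finally show ?thesis .
  qed
  from sq_summableI[OF this]
  show "sq_summable (\<lambda>k. f k + g k)" and "l2norm (\<lambda>k. f k + g k) \<le> l2norm f + l2norm g"
    by auto
qed

lemma sq_summable_mult:
  assumes "sq_summable f" "\<And>k. norm (g k) = a * norm (f k)" "a \<ge> 0"
  shows "sq_summable g" and "l2norm g = a * l2norm f"
proof -
  show "sq_summable g"
    using assms unfolding sq_summable_def
    by (simp add: power_mult_distrib summable_on_cmult_right)
  show "l2norm g = a * l2norm f"
    unfolding l2norm_def assms(2) power_mult_distrib infsum_cmult_right' real_sqrt_mult
    using assms(3) by simp
qed

lemma sq_summable_finite: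
  assumes "finite {k. f k \<noteq> 0}"
  shows "sq_summable f"
  unfolding sq_summable_def
  by (rule summable_on_cong_neutral[where S = "{k. f k \<noteq> 0}", THEN iffD1])
     (use assms in auto)

lemma norm_le_l2norm: "sq_summable f \<Longrightarrow> norm (f k) \<le> l2norm f"
  using L2_set_le_l2norm[of f "{k}"] by simp


section \<open>The space of formal power series with square-summable coefficients\<close>

text \<open>A formal series \<open>\<Sum>\<^sub>k \<psi>\<^sub>k x\<^sup>k\<close> in \<open>x = (x\<^sub>1, \<dots>, x\<^sub>d)\<close> is its coefficient family, indexed by the
  multi-indices in \<^typ>\<open>nat ^ 'd\<close>; the number of variables is \<open>d = CARD('d)\<close>.\<close>

typedef (overloaded) ('b, 'd) H2 =
  "{\<psi> :: nat ^ 'd \<Rightarrow> 'b::complex_normed_vector. (\<lambda>k. (norm (\<psi> k))\<^sup>2) summable_on UNIV}"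
  morphisms h2_coeff Abs_H2
  by (rule exI[of _ "\<lambda>_. 0"]) simp

lemma sq_summable_coeff: "sq_summable (h2_coeff \<psi>)"
  using h2_coeff[of \<psi>] by (simp add: sq_summable_def)

lemma coeff_Abs_H2: "sq_summable f \<Longrightarrow> h2_coeff (Abs_H2 f) = f"
  by (simp add: Abs_H2_inverse sq_summable_def)

lemma H2_eqI: "(\<And>k. h2_coeff \<psi> k = h2_coeff \<phi> k) \<Longrightarrow> \<psi> = \<phi>"
  using h2_coeff_inject by blast

instantiation H2 :: (complex_normed_vector, finite) complex_normed_vector
begin

definition zero_H2 :: "('a, 'b) H2" where
  "zero_H2 = Abs_H2 (\<lambda>k. 0)"
definition plus_H2 :: "('a, 'b) H2 \<Rightarrow> ('a, 'b) H2 \<Rightarrow> ('a, 'b) H2" where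
  "plus_H2 \<psi> \<phi> = Abs_H2 (\<lambda>k. h2_coeff \<psi> k + h2_coeff \<phi> k)"
definition minus_H2 :: "('a, 'b) H2 \<Rightarrow> ('a, 'b) H2 \<Rightarrow> ('a, 'b) H2" where
  "minus_H2 \<psi> \<phi> = Abs_H2 (\<lambda>k. h2_coeff \<psi> k - h2_coeff \<phi> k)"
definition uminus_H2 :: "('a, 'b) H2 \<Rightarrow> ('a, 'b) H2" where
  "uminus_H2 \<psi> = Abs_H2 (\<lambda>k. - h2_coeff \<psi> k)"
definition scaleR_H2 :: "real \<Rightarrow> ('a, 'b) H2 \<Rightarrow> ('a, 'b) H2" where
  "scaleR_H2 r \<psi> = Abs_H2 (\<lambda>k. r *\<^sub>R h2_coeff \<psi> k)"
definition scaleC_H2 :: "complex \<Rightarrow> ('a, 'b) H2 \<Rightarrow> ('a, 'b) H2" where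
  "scaleC_H2 c \<psi> = Abs_H2 (\<lambda>k. c *\<^sub>C h2_coeff \<psi> k)"
definition norm_H2 :: "('a, 'b) H2 \<Rightarrow> real" where
  "norm_H2 \<psi> = sqrt (\<Sum>\<^sub>\<infinity>k. (norm (h2_coeff \<psi> k))\<^sup>2)"
definition dist_H2 :: "('a, 'b) H2 \<Rightarrow> ('a, 'b) H2 \<Rightarrow> real" where
  "dist_H2 \<psi> \<phi> = norm (\<psi> - \<phi>)"
definition sgn_H2 :: "('a, 'b) H2 \<Rightarrow> ('a, 'b) H2" where
  "sgn_H2 \<psi> = inverse (norm \<psi>) *\<^sub>R \<psi>"
definition uniformity_H2 :: "(('a, 'b) H2 \<times> ('a, 'b) H2) filter" where
  "uniformity_H2 = (INF e\<in>{0<..}. principal {(\<psi>, \<phi>). dist \<psi> \<phi> < (e::real)})"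
definition open_H2 :: "('a, 'b) H2 set \<Rightarrow> bool" where
  "open_H2 U \<longleftrightarrow> (\<forall>x\<in>U. \<forall>\<^sub>F (x', y) in uniformity. x' = x \<longrightarrow> y \<in> U)"

lemma norm_H2_l2norm: "norm \<psi> = l2norm (h2_coeff \<psi>)" for \<psi> :: "('a, 'b) H2"
  by (simp add: norm_H2_def l2norm_def)

lemma coeff_zero: "h2_coeff (0 :: ('a, 'b) H2) k = 0"
  unfolding zero_H2_def by (subst coeff_Abs_H2) (simp_all add: sq_summable_finite)

lemma coeff_plus: "h2_coeff (\<psi> + \<phi> :: ('a, 'b) H2) k = h2_coeff \<psi> k + h2_coeff \<phi> k"
  unfolding plus_H2_def
  by (subst coeff_Abs_H2) (simp_all add: sq_summable_add sq_summable_coeff)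

lemma coeff_uminus: "h2_coeff (- \<psi> :: ('a, 'b) H2) k = - h2_coeff \<psi> k"
  unfolding uminus_H2_def
  by (subst coeff_Abs_H2)
     (auto intro: sq_summable_mult(1)[OF sq_summable_coeff[of \<psi>], where a = 1])

lemma coeff_minus: "h2_coeff (\<psi> - \<phi> :: ('a, 'b) H2) k = h2_coeff \<psi> k - h2_coeff \<phi> k"
proof -
  have "sq_summable (\<lambda>k. h2_coeff \<psi> k + h2_coeff (- \<phi>) k)"
    by (intro sq_summable_add sq_summable_coeff)
  then show ?thesis
    unfolding minus_H2_def by (subst coeff_Abs_H2) (simp_all add: coeff_uminus)
qed

lemma coeff_scaleR: "h2_coeff (r *\<^sub>R \<psi> :: ('a, 'b) H2) k = r *\<^sub>R h2_coeff \<psi> k"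
  unfolding scaleR_H2_def
  by (subst coeff_Abs_H2)
     (auto intro: sq_summable_mult(1)[OF sq_summable_coeff[of \<psi>], where a = "\<bar>r\<bar>"])

lemma coeff_scaleC: "h2_coeff (c *\<^sub>C \<psi> :: ('a, 'b) H2) k = c *\<^sub>C h2_coeff \<psi> k"
  unfolding scaleC_H2_def
  by (subst coeff_Abs_H2)
     (auto simp: norm_scaleC
       intro: sq_summable_mult(1)[OF sq_summable_coeff[of \<psi>], where a = "cmod c"])

lemmas coeff_simps =
  coeff_zero coeff_plus coeff_uminus coeff_minus coeff_scaleR coeff_scaleC

instance
proof
  fix \<psi> \<phi> \<theta> :: "('a, 'b) H2" and r s :: real and b c :: complex
  show "\<psi> + \<phi> + \<theta> = \<psi> + (\<phi> + \<theta>)" by (rule H2_eqI) (simp add: coeff_simps)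
  show "\<psi> + \<phi> = \<phi> + \<psi>" by (rule H2_eqI) (simp add: coeff_simps)
  show "0 + \<psi> = \<psi>" by (rule H2_eqI) (simp add: coeff_simps)
  show "- \<psi> + \<psi> = 0" by (rule H2_eqI) (simp add: coeff_simps)
  show "\<psi> - \<phi> = \<psi> + - \<phi>" by (rule H2_eqI) (simp add: coeff_simps)
  show "r *\<^sub>R (\<psi> + \<phi>) = r *\<^sub>R \<psi> + r *\<^sub>R \<phi>"
    by (rule H2_eqI) (simp add: coeff_simps scaleR_add_right)
  show "(r + s) *\<^sub>R \<psi> = r *\<^sub>R \<psi> + s *\<^sub>R \<psi>"
    by (rule H2_eqI) (simp add: coeff_simps scaleR_add_left)
  show "r *\<^sub>R s *\<^sub>R \<psi> = (r * s) *\<^sub>R \<psi>" by (rule H2_eqI) (simp add: coeff_simps)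
  show "1 *\<^sub>R \<psi> = \<psi>" by (rule H2_eqI) (simp add: coeff_simps)
  show "c *\<^sub>C (\<psi> + \<phi>) = c *\<^sub>C \<psi> + c *\<^sub>C \<phi>"
    by (rule H2_eqI) (simp add: coeff_simps scaleC_add_right)
  show "(b + c) *\<^sub>C \<psi> = b *\<^sub>C \<psi> + c *\<^sub>C \<psi>"
    by (rule H2_eqI) (simp add: coeff_simps scaleC_add_left)
  show "b *\<^sub>C c *\<^sub>C \<psi> = (b * c) *\<^sub>C \<psi>"
    by (rule H2_eqI) (simp add: coeff_simps scaleC_scaleC)
  show "complex_of_real r *\<^sub>C \<psi> = r *\<^sub>R \<psi>"
    by (rule H2_eqI) (simp add: coeff_simps scaleC_complex_of_real)
  show "dist \<psi> \<phi> = norm (\<psi> - \<phi>)" by (rule dist_H2_def)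
  show "sgn \<psi> = inverse (norm \<psi>) *\<^sub>R \<psi>" by (rule sgn_H2_def)
  show "uniformity = (INF e\<in>{0<..}. principal {(\<psi>, \<phi> :: ('a, 'b) H2). dist \<psi> \<phi> < e})"
    by (rule uniformity_H2_def)
  show "open U \<longleftrightarrow> (\<forall>x\<in>U. \<forall>\<^sub>F (x', y) in uniformity. x' = x \<longrightarrow> y \<in> U)"
    for U :: "('a, 'b) H2 set" by (rule open_H2_def)
  show "norm \<psi> = 0 \<longleftrightarrow> \<psi> = 0"
  proof
    assume "norm \<psi> = 0"
    then have "norm (h2_coeff \<psi> k) \<le> 0" for k
      using norm_le_l2norm[OF sq_summable_coeff[of \<psi>], of k] by (simp add: norm_H2_l2norm)
    then show "\<psi> = 0" by (intro H2_eqI) (simp add: coeff_simps)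
  qed (simp add: norm_H2_def coeff_simps)
  show "norm (\<psi> + \<phi>) \<le> norm \<psi> + norm \<phi>"
    using sq_summable_add(2)[OF sq_summable_coeff[of \<psi>] sq_summable_coeff[of \<phi>]]
    by (simp add: norm_H2_l2norm coeff_plus[abs_def])
  show "norm (r *\<^sub>R \<psi>) = \<bar>r\<bar> * norm \<psi>"
    unfolding norm_H2_l2norm
    by (rule sq_summable_mult(2)[OF sq_summable_coeff]) (simp_all add: coeff_simps)
  show "norm (c *\<^sub>C \<psi>) = cmod c * norm \<psi>"
    unfolding norm_H2_l2norm
    by (rule sq_summable_mult(2)[OF sq_summable_coeff]) (simp_all add: coeff_simps norm_scaleC)
qed

end

instance H2 :: (complex_banach, finite) complex_banach
proof
  fix X :: "nat \<Rightarrow> ('a, 'b) H2"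
  assume X: "Cauchy X"
  define c where "c n = h2_coeff (X n)" for n
  have coeff_le: "norm (c m k - c n k) \<le> norm (X m - X n)" for m n k
    using norm_le_l2norm[OF sq_summable_coeff[of "X m - X n"], of k]
    by (simp add: norm_H2_l2norm coeff_minus c_def)
  have "Cauchy (\<lambda>n. c n k)" for k
  proof (rule metric_CauchyI)
    fix e :: real assume "e > 0"
    then obtain M where M: "\<And>m n. m \<ge> M \<Longrightarrow> n \<ge> M \<Longrightarrow> dist (X m) (X n) < e"
      using metric_CauchyD[OF X, of e] by auto
    have "dist (c m k) (c n k) < e" if "m \<ge> M" "n \<ge> M" for m n
      using M[OF that] coeff_le[of m k n] by (simp add: dist_norm)
    then show "\<exists>M. \<forall>m\<ge>M. \<forall>n\<ge>M. dist (c m k) (c n k) < e" by blast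
  qed
  then obtain l where l: "\<And>k. (\<lambda>n. c n k) \<longlonglongrightarrow> l k"
    unfolding Cauchy_convergent_iff convergent_def by metis
  have key: "\<exists>M. \<forall>n\<ge>M. sq_summable (\<lambda>k. c n k - l k) \<and> l2norm (\<lambda>k. c n k - l k) \<le> e"
    if e: "e > 0" for e
  proof -
    obtain M where M: "\<And>m n. m \<ge> M \<Longrightarrow> n \<ge> M \<Longrightarrow> dist (X m) (X n) < e"
      using metric_CauchyD[OF X e] by auto
    have "L2_set (\<lambda>k. norm (c n k - l k)) F \<le> e" if n: "n \<ge> M" and F: "finite F" for n F
    proof (rule LIMSEQ_le_const2)
      show "(\<lambda>m. L2_set (\<lambda>k. norm (c n k - c m k)) F)
          \<longlonglongrightarrow> L2_set (\<lambda>k. norm (c n k - l k)) F"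
        unfolding L2_set_def by (intro tendsto_intros l)
      have "L2_set (\<lambda>k. norm (c n k - c m k)) F \<le> e" if "m \<ge> M" for m
        using L2_set_le_l2norm[OF sq_summable_coeff[of "X n - X m"] F] M[OF n that]
        by (simp add: norm_H2_l2norm[symmetric] coeff_minus c_def dist_norm)
      then show "\<exists>N. \<forall>m\<ge>N. L2_set (\<lambda>k. norm (c n k - c m k)) F \<le> e" by blast
    qed
    note bound = this
    have "sq_summable (\<lambda>k. c n k - l k) \<and> l2norm (\<lambda>k. c n k - l k) \<le> e" if "n \<ge> M" for n
      using sq_summableI[of "\<lambda>k. c n k - l k" e] bound[OF that] by blast
    then show ?thesis by blast
  qed
  obtain M where "sq_summable (\<lambda>k. c M k - l k)"
    using key[of 1] by auto
  then have "sq_summable (\<lambda>k. - (c M k - l k))"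
    by (rule sq_summable_mult(1)[where a = 1]) (simp_all add: norm_minus_commute)
  from sq_summable_add(1)[OF this sq_summable_coeff[of "X M"]]
  have "sq_summable l" by (simp add: c_def)
  then have "h2_coeff (X n - Abs_H2 l) = (\<lambda>k. c n k - l k)" for n
    by (auto simp: coeff_minus coeff_Abs_H2 c_def)
  then have "\<exists>M. \<forall>n\<ge>M. norm (X n - Abs_H2 l) \<le> e" if "e > 0" for e
    using key[OF that] by (simp add: norm_H2_l2norm) blast
  then have "\<exists>M. \<forall>n\<ge>M. norm (X n - Abs_H2 l) < e" if "e > 0" for e
    by (meson that dense order_le_less_trans)
  then have "X \<longlonglongrightarrow> Abs_H2 l" by (intro LIMSEQ_I) simp
  then show "convergent X" by (auto simp: convergent_def)
qed


section \<open>The space is the completion of the polynomial space\<close>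

text \<open>\<open>\<R>[x]\<close> as a subset of the space of series, from which it inherits the polynomial norm.\<close>

definition polynomials_over ::
    "('b::complex_normed_vector, 'm) ring_scheme \<Rightarrow> ('b, 'd::finite) H2 set" where
  "polynomials_over R = {\<psi>. (\<forall>k. h2_coeff \<psi> k \<in> carrier R) \<and>
     (\<exists>K. \<forall>k. (\<Sum>j\<in>UNIV. k $ j) > K \<longrightarrow> h2_coeff \<psi> k = 0)}"

lemma closure_polynomials_over:
  fixes R :: "('b::complex_normed_vector, 'm) ring_scheme"
  assumes R: "normed_comm_ring R" and dense: "closure (carrier R) = UNIV"
  shows "closure (polynomials_over R :: ('b, 'd::finite) H2 set) = UNIV"
proof -
  have "\<exists>p\<in>polynomials_over R. dist p \<psi> < e" if e: "e > 0" for \<psi> :: "('b, 'd) H2" and e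
  proof -
    define f where "f = h2_coeff \<psi>"
    define S where "S = (\<Sum>\<^sub>\<infinity>k. (norm (f k))\<^sup>2)"
    have "(\<lambda>k. (norm (f k))\<^sup>2) summable_on UNIV"
      using sq_summable_coeff[of \<psi>] by (simp add: f_def sq_summable_def)
    then have lim: "((\<lambda>F. \<Sum>k\<in>F. (norm (f k))\<^sup>2) \<longlongrightarrow> S) (finite_subsets_at_top UNIV)"
      unfolding S_def by (rule infsum_tendsto)
    have "\<forall>\<^sub>F F in finite_subsets_at_top UNIV. (\<Sum>k\<in>F. (norm (f k))\<^sup>2) > S - (e/4)\<^sup>2"
      using e by (intro order_tendstoD(1)[OF lim]) simp
    then obtain F where F: "finite F"
      and gt: "\<And>G. finite G \<Longrightarrow> F \<subseteq> G \<Longrightarrow> (\<Sum>k\<in>G. (norm (f k))\<^sup>2) > S - (e/4)\<^sup>2"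
      unfolding eventually_finite_subsets_at_top by auto
    define \<delta> where "\<delta> = (e / 4) / (real (card F) + 1)"
    have "real (card F) + 1 \<noteq> 0" by linarith
    have \<delta>: "\<delta> > 0" using e by (simp add: \<delta>_def)
    have "\<exists>y\<in>carrier R. dist y (f k) < \<delta>" for k
      using dense \<delta> closure_approachable[of "f k" "carrier R"] by auto
    then obtain y where y: "\<And>k. y k \<in> carrier R" "\<And>k. dist (y k) (f k) < \<delta>" by metis
    define q where "q k = (if k \<in> F then y k else 0)" for k
    have "sq_summable q"
      by (rule sq_summable_finite, rule finite_subset[OF _ F]) (auto simp: q_def)
    then have cq: "h2_coeff (Abs_H2 q) = q" by (rule coeff_Abs_H2)
    have "q k = 0" if "(\<Sum>j\<in>UNIV. k $ j) > Max (insert 0 ((\<lambda>k. \<Sum>j\<in>UNIV. k $ j) ` F))" for k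
      using that F by (auto simp: q_def)
    then have "Abs_H2 q \<in> polynomials_over R"
      using y(1) normed_comm_ring_zero(2)[OF R]
      unfolding polynomials_over_def mem_Collect_eq cq by (metis q_def)
    moreover have "dist (Abs_H2 q) \<psi> < e"
    proof -
      have "L2_set (\<lambda>k. norm (q k - f k)) G \<le> e/4 + e/4" if G: "finite G" for G
      proof -
        have "L2_set (\<lambda>k. norm (q k - f k)) G
            \<le> L2_set (\<lambda>k. (if k \<in> F then \<delta> else 0) + (if k \<in> F then 0 else norm (f k))) G"
          using y(2) by (intro L2_set_mono) (auto simp: q_def dist_norm less_imp_le)
        also have "\<dots> \<le> L2_set (\<lambda>k. if k \<in> F then \<delta> else 0) G
                        + L2_set (\<lambda>k. if k \<in> F then 0 else norm (f k)) G"
          by (rule L2_set_triangle_ineq)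
        also have "L2_set (\<lambda>k. if k \<in> F then \<delta> else 0) G \<le> (\<Sum>k\<in>G. if k \<in> F then \<delta> else 0)"
          using \<delta> by (intro L2_set_le_sum) auto
        also have "\<dots> = real (card (G \<inter> F)) * \<delta>"
          using G by (simp add: sum.If_cases Int_def)
        also have "\<dots> \<le> (real (card F) + 1) * \<delta>"
          using \<delta> card_mono[OF F, of "G \<inter> F"] by (intro mult_right_mono) auto
        also have "\<dots> = e/4"
          unfolding \<delta>_def times_divide_eq_right[of _ "e / 4"]
          by (rule nonzero_mult_div_cancel_left) fact
        also have "L2_set (\<lambda>k. if k \<in> F then 0 else norm (f k)) G \<le> e/4"
        proof -
          have "(\<Sum>k\<in>G. (if k \<in> F then 0 else norm (f k))\<^sup>2) = (\<Sum>k\<in>G - F. (norm (f k))\<^sup>2)"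
            using G by (intro sum.mono_neutral_cong_right) auto
          moreover have "(\<Sum>k\<in>G \<union> F. (norm (f k))\<^sup>2)
              = (\<Sum>k\<in>F. (norm (f k))\<^sup>2) + (\<Sum>k\<in>G - F. (norm (f k))\<^sup>2)"
            using G F by (subst sum.union_disjoint[symmetric]) (auto intro: sum.cong)
          moreover have "(\<Sum>k\<in>G \<union> F. (norm (f k))\<^sup>2) \<le> S"
            unfolding S_def using G F sq_summable_coeff[of \<psi>]
            by (intro finite_sum_le_infsum) (auto simp: f_def sq_summable_def)
          ultimately have "(\<Sum>k\<in>G. (if k \<in> F then 0 else norm (f k))\<^sup>2) \<le> (e/4)\<^sup>2"
            using gt[OF F] by simp
          then show ?thesis unfolding L2_set_def
            using e by (intro real_le_lsqrt) (auto intro: sum_nonneg)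
        qed
        finally show ?thesis by simp
      qed
      from sq_summableI(2)[OF this] have "l2norm (\<lambda>k. q k - f k) \<le> e/4 + e/4" .
      then show ?thesis
        using e by (simp add: dist_norm norm_H2_l2norm coeff_minus[abs_def] cq f_def)
    qed
    ultimately show ?thesis by blast
  qed
  then show ?thesis by (auto simp: closure_approachable)
qed

end

theory Submission
  imports Defs
begin

text \<open>Reflexivity passes from \<open>B\<close> to \<open>H\<^sup>2\<^sub>B\<close>, and separability of \<open>B\<close> yields a countable family of
  functionals separating the points of \<open>H\<^sup>2\<^sub>B\<close>, obtained by applying countably many norming
  functionals to the coefficients. In a reflexive space, every bounded sequence has weak cluster
  points, because by Tychonoff's theorem its evaluations have cluster points in the bidual. Choosing
  a subsequence along which all functionals of the countable family converge makes the cluster point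
  unique, so that the subsequence converges weakly. This avoids separability of the dual.\<close>

section \<open>Norming functionals\<close>

definition sublinear :: "('a::real_vector \<Rightarrow> real) \<Rightarrow> bool" where
  "sublinear q \<longleftrightarrow> (\<forall>x y. q (x + y) \<le> q x + q y) \<and> (\<forall>a>0. \<forall>x. q (a *\<^sub>R x) \<le> a * q x)"

lemma sublinear_add: "sublinear q \<Longrightarrow> q (x + y) \<le> q x + q y"
  by (simp add: sublinear_def)

lemma sublinear_0:
  assumes "sublinear q"
  shows "q 0 = 0"
proof -
  \<comment> \<open>The factor 1/2 gives \<open>q 0 \<le> 0\<close>; subadditivity at 0 gives the
    opposite sign.\<close>
  have "q ((1/2) *\<^sub>R 0) \<le> (1/2) * q 0"
    using assms unfolding sublinear_def by (meson half_gt_zero zero_less_one)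
  then show ?thesis using sublinear_add[OF assms, of 0 0] by simp
qed

text \<open>The definition contains only one inequality, which is easier to verify for infima. The
  reverse one comes from scaling \<open>a *\<^sub>R x\<close> back by
  \<open>inverse a\<close>.\<close>

lemma sublinear_scaleR:
  assumes q: "sublinear q" and a: "0 \<le> a"
  shows "q (a *\<^sub>R x) = a * q x"
proof (cases "a = 0")
  case False
  then have "a > 0" using a by simp
  have "q (inverse a *\<^sub>R a *\<^sub>R x) \<le> inverse a * q (a *\<^sub>R x)"
    using q \<open>a > 0\<close> unfolding sublinear_def by (meson positive_imp_inverse_positive)
  then have "a * q x \<le> q (a *\<^sub>R x)" using \<open>a > 0\<close> by (simp add: field_simps)
  moreover have "q (a *\<^sub>R x) \<le> a * q x" using q \<open>a > 0\<close> by (simp add: sublinear_def)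
  ultimately show ?thesis by simp
qed (simp add: sublinear_0[OF q])

lemma sublinear_uminus: "sublinear q \<Longrightarrow> - q (- x) \<le> q x"
  using sublinear_add[of q x "- x"] by (simp add: sublinear_0)

text \<open>For sublinear \<open>q\<close> this is the one-sided directional derivative of
  \<open>q\<close> at \<open>y\<close> in direction \<open>x\<close>: the difference quotients with
  step \<open>1 / t\<close> decrease as \<open>t\<close> grows. It lies below \<open>q\<close> (take
  \<open>t = 0\<close>) and is at most \<open>- q y\<close> at \<open>- y\<close> (take
  \<open>t = 1\<close>).\<close>

definition sublinear_along :: "'a::real_vector \<Rightarrow> ('a \<Rightarrow> real) \<Rightarrow> 'a \<Rightarrow> real" where
  "sublinear_along y q x = (INF t\<in>{0..}. q (x + t *\<^sub>R y) - t * q y)"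

lemma sublinear_along_le:
  assumes q: "sublinear q" and t: "0 \<le> t"
  shows "sublinear_along y q x \<le> q (x + t *\<^sub>R y) - t * q y"
  unfolding sublinear_along_def
proof (rule cINF_lower)
  \<comment> \<open>A real infimum needs a lower bound: \<open>s * q y = q (s *\<^sub>R y)\<close>
    is at most \<open>q (x + s *\<^sub>R y) + q (- x)\<close>.\<close>
  have "- q (- x) \<le> q (x + s *\<^sub>R y) - s * q y" if "0 \<le> s" for s
    using sublinear_add[OF q, of "x + s *\<^sub>R y" "- x"] sublinear_scaleR[OF q that, of y] by simp
  then show "bdd_below ((\<lambda>t. q (x + t *\<^sub>R y) - t * q y) ` {0..})"
    by (intro bdd_belowI2[where m = "- q (- x)"]) simp
qed (use t in simp)

lemma sublinear_along_greatest:
  "(\<And>t. 0 \<le> t \<Longrightarrow> c \<le> q (x + t *\<^sub>R y) - t * q y) \<Longrightarrow> c \<le> sublinear_along y q x"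
  unfolding sublinear_along_def by (rule cINF_greatest) auto

text \<open>Parameters \<open>t\<close> for \<open>x\<close> and \<open>s\<close> for
  \<open>z\<close> combine to \<open>t + s\<close> for \<open>x + z\<close>, and scaling by
  \<open>a\<close> turns \<open>t\<close> into \<open>a * t\<close>. The two infima in the sum are
  taken one after the other.\<close>

lemma sublinear_sublinear_along:
  assumes q: "sublinear q"
  shows "sublinear (sublinear_along y q)"
  unfolding sublinear_def
proof (intro conjI allI impI)
  fix x z
  let ?s = "sublinear_along y q"
  have 1: "?s (x + z) - (q (x + t *\<^sub>R y) - t * q y) \<le> ?s z" if t: "0 \<le> t" for t
  proof (rule sublinear_along_greatest)
    fix s :: real assume s: "0 \<le> s"
    have "?s (x + z) \<le> q ((x + t *\<^sub>R y) + (z + s *\<^sub>R y)) - (t + s) * q y"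
      using sublinear_along_le[OF q, of "t + s" y "x + z"] s t
      by (simp add: algebra_simps)
    then show "?s (x + z) - (q (x + t *\<^sub>R y) - t * q y) \<le> q (z + s *\<^sub>R y) - s * q y"
      using sublinear_add[OF q, of "x + t *\<^sub>R y" "z + s *\<^sub>R y"] by (simp add: algebra_simps)
  qed
  have "?s (x + z) - ?s z \<le> ?s x"
    by (rule sublinear_along_greatest) (use 1 in \<open>force simp: algebra_simps\<close>)
  then show "?s (x + z) \<le> ?s x + ?s z" by simp
next
  fix a :: real and x assume a: "0 < a"
  let ?s = "sublinear_along y q"
  have "?s (a *\<^sub>R x) / a \<le> ?s x"
  proof (rule sublinear_along_greatest)
    fix t :: real assume t: "0 \<le> t"
    have "?s (a *\<^sub>R x) \<le> q (a *\<^sub>R (x + t *\<^sub>R y)) - a * t * q y"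
      using sublinear_along_le[OF q, of "a * t" y "a *\<^sub>R x"] a t
      by (simp add: scaleR_add_right)
    also have "\<dots> = a * (q (x + t *\<^sub>R y) - t * q y)"
      using sublinear_scaleR[OF q, of a "x + t *\<^sub>R y"] a by (simp add: right_diff_distrib)
    finally show "?s (a *\<^sub>R x) / a \<le> q (x + t *\<^sub>R y) - t * q y"
      using a by (simp add: field_simps)
  qed
  then show "?s (a *\<^sub>R x) \<le> a * ?s x" using a by (simp add: field_simps)
qed

text \<open>Hahn--Banach without partial functionals: a minimal sublinear functional \<open>m\<close> coincides with
  all its \<^term>\<open>sublinear_along y m\<close>, which forces \<open>m (x + y) \<ge> m x + m y\<close>.\<close>

lemma ex_linear_le_sublinear:
  fixes p :: "'a::real_vector \<Rightarrow> real"
  assumes p: "sublinear p"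
  shows "\<exists>u. linear u \<and> (\<forall>x. u x \<le> p x)"
proof -
  define A where "A = {q. sublinear q \<and> q \<le> p}"
  have "\<exists>m\<in>A. \<forall>q\<in>A. q \<le> m \<longrightarrow> q = m"
  proof (rule predicate_Zorn)
    \<comment> \<open>The order is reversed, so that Zorn's lemma yields a minimal element and
      chains need lower bounds.\<close>
    show "partial_order_on A (relation_of (\<lambda>x y. y \<le> x) A)"
      by (rule partial_order_on_relation_ofI) auto
  next
    fix C assume "C \<in> Chains (relation_of (\<lambda>x y. y \<le> x) A)"
    then have chain: "q \<le> q' \<or> q' \<le> q" if "q \<in> C" "q' \<in> C" for q q'
      using that by (auto simp: Chains_def relation_of_def)
    have sub: "sublinear q" "q \<le> p" if "q \<in> C" for q
      using that \<open>C \<in> _\<close> by (auto simp: Chains_def relation_of_def A_def)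
    show "\<exists>u\<in>A. \<forall>q\<in>C. u \<le> q"
    proof (cases "C = {}")
      case True
      then show ?thesis using p by (auto simp: A_def)
    next
      case False
      \<comment> \<open>The lower bound is the pointwise infimum; it is finite because every member
        of the chain is at least \<open>- p (- x)\<close> at \<open>x\<close>.\<close>
      define u where "u x = (INF q\<in>C. q x)" for x
      have "- p (- x) \<le> q x" if "q \<in> C" for q x
        using sublinear_uminus[OF sub(1)[OF that], of x] le_funD[OF sub(2)[OF that], of "- x"]
        by linarith
      then have "bdd_below ((\<lambda>q. q x) ` C)" for x
        by (intro bdd_belowI2[where m = "- p (- x)"])
      then have le: "u x \<le> q x" if "q \<in> C" for q x
        unfolding u_def by (rule cINF_lower[OF _ that])
      have ge: "c \<le> u x" if "\<And>q. q \<in> C \<Longrightarrow> c \<le> q x" for c x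
        unfolding u_def using False that by (rule cINF_greatest)
      have "sublinear u" unfolding sublinear_def
      proof (intro conjI allI impI)
        fix x y
        \<comment> \<open>Subadditivity survives the infimum because the chain contains a common
          lower bound \<open>r\<close> of \<open>q\<close> and \<open>q'\<close>.\<close>
        have *: "u (x + y) \<le> q x + q' y" if qq: "q \<in> C" "q' \<in> C" for q q'
        proof -
          obtain r where r: "r \<in> C" "r \<le> q" "r \<le> q'"
            using chain[OF qq] qq by blast
          have "u (x + y) \<le> r x + r y"
            using le[OF r(1)] sublinear_add[OF sub(1)[OF r(1)]] by (meson order_trans)
          with r(2,3) show ?thesis by (meson add_mono le_funD order_trans)
        qed
        have "u (x + y) - q x \<le> u y" if "q \<in> C" for q
          by (rule ge) (use *[OF that] in \<open>force simp: algebra_simps\<close>)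
        then have "u (x + y) - u y \<le> u x"
          by (intro ge) (force simp: algebra_simps)
        then show "u (x + y) \<le> u x + u y" by simp
      next
        fix a :: real and x assume a: "0 < a"
        have "u (a *\<^sub>R x) / a \<le> u x"
        proof (rule ge)
          fix q assume "q \<in> C"
          then show "u (a *\<^sub>R x) / a \<le> q x"
            using le[of q "a *\<^sub>R x"] sublinear_scaleR[OF sub(1)[of q], of a x] a
            by (simp add: field_simps)
        qed
        then show "u (a *\<^sub>R x) \<le> a * u x" using a by (simp add: field_simps)
      qed
      moreover have "u \<le> p"
        using False le sub(2) by (meson all_not_in_conv le_funI le_funD order_trans)
      ultimately show ?thesis using le by (auto simp: A_def le_fun_def)
    qed
  qed
  then obtain m where m: "sublinear m" "m \<le> p"
    and min: "\<And>q. sublinear q \<Longrightarrow> q \<le> p \<Longrightarrow> q \<le> m \<Longrightarrow> q = m"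
    unfolding A_def by blast
  have along: "sublinear_along y m = m" for y
  proof (rule min)
    show le: "sublinear_along y m \<le> m"
      using sublinear_along_le[OF m(1), of 0 y] by (simp add: le_fun_def)
    then show "sublinear_along y m \<le> p" using m(2) by simp
  qed (rule sublinear_sublinear_along[OF m(1)])
  have add: "m (x + y) = m x + m y" for x y
    using sublinear_along_le[OF m(1), of 1 y x] sublinear_add[OF m(1), of x y] along by simp
  have minus: "m (- x) = - m x" for x
    using add[of x "- x"] sublinear_0[OF m(1)] by simp
  have "m (a *\<^sub>R x) = a * m x" for a x
  proof (cases "0 \<le> a")
    case False
    then show ?thesis
      using sublinear_scaleR[OF m(1), of "- a" x] minus[of "a *\<^sub>R x"] by simp
  qed (rule sublinear_scaleR[OF m(1)])
  with add have "linear m" by (intro linearI) auto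
  with m(2) show ?thesis by (auto simp: le_fun_def)
qed

section \<open>The complex dual space and its norming functionals\<close>

lemma bounded_linear_dual: "f \<in> dual_space \<Longrightarrow> bounded_linear f"
  by (simp add: dual_space_def)

lemma dual_scaleC: "f \<in> dual_space \<Longrightarrow> f (c *\<^sub>C x) = c * f x"
  by (simp add: dual_space_def)

lemma dual_bound: "f \<in> dual_space \<Longrightarrow> cmod (f x) \<le> onorm f * norm x"
  by (intro onorm bounded_linear_dual)

lemmas dual_linear_simps =
  linear_add[OF bounded_linear.linear[OF bounded_linear_dual]]
  linear_diff[OF bounded_linear.linear[OF bounded_linear_dual]]
  linear_0[OF bounded_linear.linear[OF bounded_linear_dual]]
  linear_sum[OF bounded_linear.linear[OF bounded_linear_dual]]
  dual_scaleC

lemma dual_spaceI: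
  assumes "\<And>x y. f (x + y) = f x + f y" "\<And>c x. f (c *\<^sub>C x) = c * f x"
    and "\<And>x. cmod (f x) \<le> K * norm x"
  shows "f \<in> dual_space"
proof -
  have "bounded_linear f"
  proof (rule bounded_linear_intro)
    show "f (r *\<^sub>R x) = r *\<^sub>R f x" for r x
      using assms(2)[of "complex_of_real r" x]
      by (simp add: scaleC_complex_of_real scaleR_conv_of_real)
    show "cmod (f x) \<le> norm x * K" for x using assms(3)[of x] by (simp add: mult.commute)
  qed (rule assms(1))
  then show ?thesis using assms(2) by (simp add: dual_space_def)
qed

lemma dual_zero: "(\<lambda>x. 0) \<in> dual_space"
  by (rule dual_spaceI[where K = 0]) auto

lemma dual_add: "f \<in> dual_space \<Longrightarrow> g \<in> dual_space \<Longrightarrow> (\<lambda>x. f x + g x) \<in> dual_space"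
  by (auto simp: dual_space_def algebra_simps intro: bounded_linear_add)

lemma dual_mult: "f \<in> dual_space \<Longrightarrow> (\<lambda>x. c * f x) \<in> dual_space"
  by (auto simp: dual_space_def algebra_simps intro: bounded_linear_const_mult)

lemma dual_sum: "(\<And>i. i \<in> A \<Longrightarrow> f i \<in> dual_space) \<Longrightarrow> (\<lambda>x. \<Sum>i\<in>A. f i x) \<in> dual_space"
  by (induction A rule: infinite_finite_induct) (simp_all add: dual_zero dual_add)

text \<open>Used to make the value of a complex-linear functional real and nonnegative without
  changing the norm of its argument.\<close>

lemma ex_unit_rotation: "\<exists>c. cmod c = 1 \<and> c * z = complex_of_real (cmod z)"
proof (cases "z = 0")
  case True
  then show ?thesis by (auto intro: exI[of _ 1])
next
  case False
  then show ?thesis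
    by (intro exI[of _ "complex_of_real (cmod z) / z"]) (simp add: norm_divide)
qed

text \<open>The real Hahn-Banach theorem gives a real functional \<open>u\<close>; it is the real
  part of the complex-linear \<open>f\<close>. Rotating the argument until \<open>f\<close> is real
  there shows that passing from \<open>u\<close> to \<open>f\<close> preserves the norm
  bound.\<close>

lemma ex_norming_functional:
  fixes x0 :: "'a::complex_normed_vector"
  shows "\<exists>f\<in>dual_space. f x0 = complex_of_real (norm x0) \<and> (\<forall>x. cmod (f x) \<le> norm x)"
proof -
  have sub: "sublinear (norm :: 'a \<Rightarrow> real)"
    by (simp add: sublinear_def norm_triangle_ineq)
  \<comment> \<open>starting from \<^term>\<open>sublinear_along x0 norm\<close> forces \<open>u (- x0) \<le> - norm x0\<close>\<close>
  obtain u where u: "linear u" "\<And>x. u x \<le> sublinear_along x0 norm x"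
    using ex_linear_le_sublinear[OF sublinear_sublinear_along[OF sub]] by blast
  have le: "u x \<le> norm x" for x
    using u(2)[of x] sublinear_along_le[OF sub, of 0 x0 x] by simp
  have "u (- x0) \<le> - norm x0"
    using u(2)[of "- x0"] sublinear_along_le[OF sub, of 1 x0 "- x0"] by simp
  then have ge: "norm x0 \<le> u x0" using linear_neg[OF u(1)] by simp
  note u_simps = linear_add[OF u(1)] linear_neg[OF u(1)] linear_diff[OF u(1)]
  define f where "f x = Complex (u x) (- u (\<i> *\<^sub>C x))" for x
  have f_add: "f (x + y) = f x + f y" for x y
    by (simp add: f_def u_simps scaleC_add_right complex_eq_iff)
  have uC: "u (c *\<^sub>C x) = Re c * u x + Im c * u (\<i> *\<^sub>C x)" for c x
  proof -
    have "c *\<^sub>C x = (complex_of_real (Re c) + complex_of_real (Im c) * \<i>) *\<^sub>C x"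
      by (metis complex_eq mult.commute)
    also have "\<dots> = Re c *\<^sub>R x + Im c *\<^sub>R \<i> *\<^sub>C x"
      by (simp add: scaleC_add_left scaleC_scaleC[symmetric] scaleC_complex_of_real)
    finally show ?thesis by (simp add: u_simps linear_scale[OF u(1)])
  qed
  have f_scaleC: "f (c *\<^sub>C x) = c * f x" for c x
    using uC[of c x] uC[of "\<i> * c" x]
    by (simp add: f_def complex_eq_iff scaleC_scaleC algebra_simps)
  have f_le: "cmod (f x) \<le> norm x" for x
  proof -
    obtain c where c: "cmod c = 1" "c * f x = complex_of_real (cmod (f x))"
      using ex_unit_rotation by blast
    have "cmod (f x) = Re (f (c *\<^sub>C x))" using c(2) by (simp add: f_scaleC)
    also have "\<dots> \<le> norm (c *\<^sub>C x)" using le by (simp add: f_def)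
    finally show ?thesis using c(1) by (simp add: norm_scaleC)
  qed
  \<comment> \<open>The modulus is at most \<open>norm x0\<close> and the real part already equals
    it, so no imaginary part is left.\<close>
  have "Re (f x0) = norm x0" using le[of x0] ge by (simp add: f_def)
  moreover have "(Re (f x0))\<^sup>2 + (Im (f x0))\<^sup>2 \<le> (norm x0)\<^sup>2"
    using power_mono[OF f_le[of x0], of 2] by (simp add: cmod_power2)
  ultimately have "f x0 = complex_of_real (norm x0)" by (simp add: complex_eq_iff)
  moreover have "f \<in> dual_space"
    using f_add f_scaleC f_le by (intro dual_spaceI[where K = 1]) auto
  ultimately show ?thesis using f_le by blast
qed

text \<open>Take norming functionals at the points of a countable dense set. If the one at
  \<open>y\<close> kills \<open>x\<close>, then \<open>norm y \<le> norm (y - x)\<close>, which is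
  impossible for \<open>y\<close> within \<open>norm x / 2\<close> of a nonzero
  \<open>x\<close>.\<close>

lemma ex_countable_separating_functionals:
  assumes "separable_space (euclidean :: 'a::complex_normed_vector topology)"
  shows "\<exists>S\<subseteq>dual_space. countable S \<and> (\<forall>x::'a. (\<forall>f\<in>S. f x = 0) \<longrightarrow> x = 0)"
proof -
  obtain D :: "'a set" where D: "countable D" "closure D = UNIV"
    using assms by (auto simp: separable_space_def)
  obtain F where F: "\<And>y::'a. F y \<in> dual_space" "\<And>y. F y y = complex_of_real (norm y)"
      "\<And>y x. cmod (F y x) \<le> norm x"
    using ex_norming_functional by metis
  have "x = 0" if x: "\<And>f. f \<in> F ` D \<Longrightarrow> f x = 0" for x
  proof (rule ccontr)
    assume "x \<noteq> 0"
    have "x \<in> closure D" using D(2) by simp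
    with \<open>x \<noteq> 0\<close> obtain y where y: "y \<in> D" "dist y x < norm x / 2"
      using closure_approachable[THEN iffD1, rule_format, of x D "norm x / 2"] by auto
    have "norm y = cmod (F y (y - x))"
      using x[of "F y"] y(1) F by (simp add: dual_linear_simps)
    also have "\<dots> < norm x / 2" using F(3)[of y "y - x"] y(2) by (simp add: dist_norm)
    finally show False
      using y(2) norm_triangle_ineq2[of x y] by (simp add: dist_norm norm_minus_commute)
  qed
  then show ?thesis using D(1) F(1) by (intro exI[of _ "F ` D"] conjI) auto
qed

section \<open>Weak compactness in reflexive spaces\<close>

text \<open>Evaluations at the points \<open>Y n\<close> lie in a product of discs, compact by
  Tychonoff's theorem. Filters replace subsequences, since this product need not be first
  countable.\<close>

lemma bidual_cluster:
  fixes Y :: "'i \<Rightarrow> 'a::complex_normed_vector"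
  assumes bdd: "bounded (range Y)" and F: "F \<noteq> bot"
  shows "\<exists>\<Phi>\<in>bidual_space. \<exists>G\<le>F. G \<noteq> bot \<and> (\<forall>f\<in>dual_space. ((\<lambda>n. f (Y n)) \<longlongrightarrow> \<Phi> f) G)"
proof -
  obtain M where M: "\<And>n. norm (Y n) \<le> M"
    using bdd by (auto simp: bounded_iff)
  \<comment> \<open>The default value 0 and radius 0 outside \<open>dual_space\<close> let the
    product range over the whole function type.\<close>
  define e where "e n f = (if f \<in> dual_space then f (Y n) else 0)" for n f
  define B where "B f = (if f \<in> dual_space then onorm f * M else 0)" for f :: "'a \<Rightarrow> complex"
  define K where "K = (\<Pi>\<^sub>E f\<in>UNIV. cball (0::complex) (B f))"
  have "compact K"
    unfolding K_def compactin_euclidean_iff[symmetric] euclidean_product_topology[symmetric]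
      compactin_PiE by simp
  moreover have e_le: "cmod (e n f) \<le> B f" for n f
  proof (cases "f \<in> dual_space")
    case True
    then have "cmod (f (Y n)) \<le> onorm f * norm (Y n)" by (rule dual_bound)
    also have "\<dots> \<le> onorm f * M"
      using M[of n] onorm_pos_le[OF bounded_linear_dual[OF True]] by (rule mult_left_mono)
    finally show ?thesis using True by (simp add: e_def B_def)
  qed (simp add: e_def B_def)
  then have "e n \<in> K" for n by (auto simp: K_def)
  moreover have "filtermap e F \<noteq> bot" using F by (simp add: filtermap_bot_iff)
  ultimately obtain \<Phi> where \<Phi>: "\<Phi> \<in> K" "inf (nhds \<Phi>) (filtermap e F) \<noteq> bot"
    unfolding compact_filter by (metis (mono_tags, lifting) always_eventually eventually_filtermap)
  define G where "G = inf F (filtercomap e (nhds \<Phi>))"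
  have G: "G \<le> F" "G \<noteq> bot"
  proof -
    show "G \<noteq> bot"
    proof
      assume "G = bot"
      then obtain P Q where PQ: "eventually P F" "eventually Q (nhds \<Phi>)" "\<And>n. P n \<Longrightarrow> \<not> Q (e n)"
        unfolding G_def trivial_limit_def eventually_inf eventually_filtercomap by metis
      have "eventually (\<lambda>h. \<not> Q h) (filtermap e F)"
        unfolding eventually_filtermap using PQ(1) by eventually_elim (rule PQ(3))
      with PQ(2) have "inf (nhds \<Phi>) (filtermap e F) = bot"
        unfolding trivial_limit_def eventually_inf
        by (intro exI[of _ Q] exI[of _ "\<lambda>h. \<not> Q h"]) simp
      with \<Phi>(2) show False by simp
    qed
  qed (simp add: G_def)
  have "filterlim e (nhds \<Phi>) G"
    unfolding G_def filterlim_iff_le_filtercomap by simp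
  have lim: "((\<lambda>n. f (Y n)) \<longlongrightarrow> \<Phi> f) G" if f: "f \<in> dual_space" for f
  proof -
    have "continuous_on UNIV (\<lambda>h::('a \<Rightarrow> complex) \<Rightarrow> complex. h f)"
      by (rule continuous_on_product_then_coordinatewise[OF continuous_on_id])
    from continuous_on_tendsto_compose[OF this \<open>filterlim e (nhds \<Phi>) G\<close>]
    show ?thesis using f by (simp add: e_def)
  qed
  \<comment> \<open>Linearity passes to \<open>\<Phi>\<close> by uniqueness of limits along
    \<open>G\<close>; the bound is membership in \<open>K\<close>.\<close>
  have "\<Phi> \<in> bidual_space" unfolding bidual_space_def mem_Collect_eq
  proof (intro conjI ballI allI exI)
    fix f g :: "'a \<Rightarrow> complex" assume fg: "f \<in> dual_space" "g \<in> dual_space"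
    from tendsto_unique[OF G(2) lim[OF dual_add[OF fg]] tendsto_add[OF lim[OF fg(1)] lim[OF fg(2)]]]
    show "\<Phi> (\<lambda>x. f x + g x) = \<Phi> f + \<Phi> g" .
  next
    fix c and f :: "'a \<Rightarrow> complex" assume f: "f \<in> dual_space"
    from tendsto_unique[OF G(2) lim[OF dual_mult[OF f]] tendsto_mult_left[OF lim[OF f]]]
    show "\<Phi> (\<lambda>x. c * f x) = c * \<Phi> f" .
  next
    fix f :: "'a \<Rightarrow> complex" assume "f \<in> dual_space"
    moreover have "cmod (\<Phi> f) \<le> B f" using \<Phi>(1) by (auto simp: K_def PiE_iff)
    ultimately show "cmod (\<Phi> f) \<le> M * onorm f" by (simp add: B_def mult.commute)
  qed
  with G lim show ?thesis by blast
qed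

text \<open>In place of a diagonal argument, a countable product of compact sets is compact and
  first countable, hence sequentially compact.\<close>

lemma seq_convergent_subseq_countable:
  fixes S :: "('a::complex_normed_vector \<Rightarrow> complex) set" and X :: "nat \<Rightarrow> 'a"
  assumes S: "countable S" "S \<subseteq> dual_space" and bdd: "bounded (range X)"
  shows "\<exists>r::nat \<Rightarrow> nat. strict_mono r \<and> (\<forall>f\<in>S. convergent (\<lambda>n. f (X (r n))))"
proof (cases "S = {}")
  case True
  then show ?thesis using strict_mono_id by auto
next
  case False
  \<comment> \<open>An enumeration of \<open>S\<close>, with repetitions if \<open>S\<close> is
    finite.\<close>
  define g where "g = from_nat_into S"
  have g: "g j \<in> S" for j using False by (simp add: g_def from_nat_into)
  define K where "K = (\<Pi>\<^sub>E j\<in>UNIV. closure (range (\<lambda>n. g j (X n))))"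
  have "bounded ((\<lambda>x. g j x) ` range X)" for j
    using g S(2) bdd by (intro bounded_linear_image) (auto intro: bounded_linear_dual)
  then have "compact (closure (range (\<lambda>n. g j (X n))))" for j
    by (simp add: image_image)
  then have "compact K"
    unfolding K_def compactin_euclidean_iff[symmetric] euclidean_product_topology[symmetric]
      compactin_PiE by simp
  moreover have "(\<lambda>j. g j (X n)) \<in> K" for n
    by (auto simp: K_def intro: subsetD[OF closure_subset])
  ultimately obtain l r where r: "strict_mono r" and l: "(\<lambda>n. (\<lambda>j. g j (X (r n)))) \<longlonglongrightarrow> l"
    using seq_compactE[OF compact_imp_seq_compact, of K "\<lambda>n j. g j (X n)"] unfolding o_def by metis
  have "(\<lambda>n. g j (X (r n))) \<longlonglongrightarrow> l j" for j
  proof -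
    have "continuous_on UNIV (\<lambda>h::nat \<Rightarrow> complex. h j)"
      by (rule continuous_on_product_then_coordinatewise[OF continuous_on_id])
    from continuous_on_tendsto_compose[OF this l] show ?thesis by simp
  qed
  moreover have "\<exists>j. f = g j" if "f \<in> S" for f
    using S(1) that by (metis from_nat_into_to_nat_on g_def)
  ultimately have "\<forall>f\<in>S. convergent (\<lambda>n. f (X (r n)))" by (metis convergentI)
  with r show ?thesis by blast
qed

text \<open>Along a subsequence on which the separating functionals converge, all weak cluster points
  coincide, and cluster points exist along every filter; hence the subsequence converges.\<close>

lemma reflexive_imp_locally_seq_weakly_compact:
  assumes refl: "reflexive_space TYPE('a::complex_normed_vector)"
    and S: "countable S" "S \<subseteq> dual_space" and sep: "\<And>x::'a. (\<forall>f\<in>S. f x = 0) \<Longrightarrow> x = 0"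
  shows "locally_seq_weakly_compact TYPE('a)"
  unfolding locally_seq_weakly_compact_def
proof (intro allI impI)
  fix X :: "nat \<Rightarrow> 'a" assume bdd: "bounded (range X)"
  obtain r :: "nat \<Rightarrow> nat"
    where r: "strict_mono r" and conv: "\<And>f. f \<in> S \<Longrightarrow> convergent (\<lambda>n. f (X (r n)))"
    using seq_convergent_subseq_countable[OF S bdd] by blast
  define Y where "Y = X \<circ> r"
  have bddY: "bounded (range Y)"
    using bdd by (rule bounded_subset) (auto simp: Y_def)
  have cluster: "\<exists>x. \<exists>G\<le>F. G \<noteq> bot \<and> (\<forall>f\<in>dual_space. ((\<lambda>n. f (Y n)) \<longlongrightarrow> f x) G)"
    if F: "F \<noteq> bot" for F :: "nat filter"
  proof -
    obtain \<Phi> G where \<Phi>: "\<Phi> \<in> bidual_space" "G \<le> F" "G \<noteq> bot"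
        "\<forall>f\<in>dual_space. ((\<lambda>n. f (Y n)) \<longlongrightarrow> \<Phi> f) G"
      using bidual_cluster[OF bddY F] by blast
    obtain x where "\<And>f. f \<in> dual_space \<Longrightarrow> \<Phi> f = f x"
      using refl \<Phi>(1) unfolding reflexive_space_def by blast
    with \<Phi> show ?thesis by (intro exI[of _ x] exI[of _ G]) simp
  qed
  have lim: "f x = lim (\<lambda>n. f (Y n))"
    if "f \<in> S" "G \<le> sequentially" "G \<noteq> bot" "\<forall>f\<in>dual_space. ((\<lambda>n. f (Y n)) \<longlongrightarrow> f x) G" for f x G
  proof (rule tendsto_unique)
    show "((\<lambda>n. f (Y n)) \<longlongrightarrow> lim (\<lambda>n. f (Y n))) G"
      using conv[OF that(1)] that(2) unfolding convergent_LIMSEQ_iff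
      by (auto simp: Y_def intro: tendsto_mono)
  qed (use that S(2) in auto)
  obtain x G where x: "G \<le> sequentially" "G \<noteq> bot" "\<forall>f\<in>dual_space. ((\<lambda>n. f (Y n)) \<longlongrightarrow> f x) G"
    using cluster[OF sequentially_bot] by blast
  have "(\<lambda>n. f (Y n)) \<longlonglongrightarrow> f x" if f: "f \<in> dual_space" for f
  proof (rule ccontr)
    assume "\<not> (\<lambda>n. f (Y n)) \<longlonglongrightarrow> f x"
    then obtain U where U: "open U" "f x \<in> U" "\<not> eventually (\<lambda>n. f (Y n) \<in> U) sequentially"
      unfolding tendsto_def by blast
    \<comment> \<open>If convergence failed, the indices with values outside \<open>U\<close> would
      carry a proper filter. Its cluster point \<open>x'\<close> must be \<open>x\<close> by
      separation, yet the values along \<open>G'\<close> never enter \<open>U\<close>.\<close>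
    define H where "H = inf sequentially (principal {n. f (Y n) \<notin> U})"
    have "H \<noteq> bot"
      using U(3) by (simp add: H_def trivial_limit_def eventually_inf_principal)
    then obtain x' G' where x': "G' \<le> H" "G' \<noteq> bot"
        "\<forall>f\<in>dual_space. ((\<lambda>n. f (Y n)) \<longlongrightarrow> f x') G'"
      using cluster by blast
    then have "G' \<le> sequentially" unfolding H_def by simp
    then have "g (x - x') = 0" if "g \<in> S" for g
      using lim[OF that x] lim[OF that _ x'(2,3)] that S(2)
      by (simp add: dual_linear_simps subset_iff)
    then have "x' = x" using sep[of "x - x'"] by simp
    with x'(3) f U(1,2) have "eventually (\<lambda>n. f (Y n) \<in> U) G'"
      by (auto dest: topological_tendstoD)
    moreover have "eventually (\<lambda>n. f (Y n) \<notin> U) G'"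
      using x'(1) by (rule filter_leD) (simp add: H_def eventually_inf_principal)
    ultimately have "eventually (\<lambda>n. False) G'" by eventually_elim simp
    with x'(2) show False by (simp add: trivial_limit_def)
  qed
  then have "weakly_converges_to (X \<circ> r) x"
    by (simp add: weakly_converges_to_def Y_def)
  with r show "\<exists>x r. strict_mono r \<and> weakly_converges_to (X \<circ> r) x" by blast
qed

section \<open>Functionals on the space of square-summable series\<close>

text \<open>The monomial with coefficient \<open>v\<close> and exponent \<open>k\<close>.\<close>

definition h2_single :: "nat ^ 'd \<Rightarrow> 'b \<Rightarrow> ('b::complex_normed_vector, 'd::finite) H2" where
  "h2_single k v = Abs_H2 (\<lambda>j. if j = k then v else 0)"

lemma coeff_single: "h2_coeff (h2_single k v) j = (if j = k then v else 0)"
proof -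
  have "sq_summable (\<lambda>j. if j = k then v else 0)"
    by (rule sq_summable_finite, rule finite_subset[of _ "{k}"]) auto
  then show ?thesis by (simp add: h2_single_def coeff_Abs_H2)
qed

lemma single_add: "h2_single k (u + v) = h2_single k u + h2_single k v"
  by (rule H2_eqI) (simp add: coeff_single coeff_simps)

lemma scaleC_zero: "c *\<^sub>C (0 :: 'a::complex_normed_vector) = 0"
  using scaleC_add_right[of c "0::'a" 0] by simp

lemma single_scaleC: "h2_single k (c *\<^sub>C v) = c *\<^sub>C h2_single k v"
  by (rule H2_eqI) (simp add: coeff_single coeff_simps scaleC_zero)

lemma coeff_sum: "h2_coeff (sum f A) k = (\<Sum>a\<in>A. h2_coeff (f a) k)"
  for f :: "'i \<Rightarrow> ('b::complex_normed_vector, 'd::finite) H2"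
  by (induction A rule: infinite_finite_induct) (simp_all add: coeff_simps)

lemma coeff_sum_single:
  "finite G \<Longrightarrow> h2_coeff (\<Sum>k\<in>G. h2_single k (v k)) j = (if j \<in> G then v j else 0)"
  by (simp add: coeff_sum coeff_single)

lemma norm_coeff_le: "norm (h2_coeff \<psi> k) \<le> norm \<psi>"
  for \<psi> :: "('b::complex_normed_vector, 'd::finite) H2"
  by (simp add: norm_H2_l2norm norm_le_l2norm sq_summable_coeff)

lemma L2_set_coeff_le: "finite G \<Longrightarrow> L2_set (\<lambda>k. norm (h2_coeff \<psi> k)) G \<le> norm \<psi>"
  for \<psi> :: "('b::complex_normed_vector, 'd::finite) H2"
  by (simp add: norm_H2_l2norm L2_set_le_l2norm sq_summable_coeff)

lemma norm_sum_single:
  assumes "finite G"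
  shows "norm (\<Sum>k\<in>G. h2_single k (v k)) = L2_set (\<lambda>k. norm (v k)) G"
proof -
  have "(\<Sum>\<^sub>\<infinity>j. (norm (if j \<in> G then v j else 0))\<^sup>2) = (\<Sum>\<^sub>\<infinity>j\<in>G. (norm (v j))\<^sup>2)"
    by (rule infsum_cong_neutral) auto
  then show ?thesis
    using assms by (simp add: norm_H2_def L2_set_def coeff_sum_single)
qed

lemma norm_single: "norm (h2_single k v) = norm v"
  using norm_sum_single[of "{k}" "\<lambda>_. v"] by simp

text \<open>The squared error of a finite partial sum is the tail of the series of squared
  coefficient norms. Hence continuous functionals are determined by their values on
  monomials.\<close>

lemma has_sum_single:
  "((\<lambda>k. h2_single k (h2_coeff \<psi> k)) has_sum \<psi>) UNIV"
  for \<psi> :: "('b::complex_normed_vector, 'd::finite) H2"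
proof -
  define T where "T G = (\<Sum>k\<in>G. h2_single k (h2_coeff \<psi> k))" for G
  define g where "g k = (norm (h2_coeff \<psi> k))\<^sup>2" for k
  have g: "g summable_on UNIV"
    using sq_summable_coeff[of \<psi>] by (simp add: sq_summable_def g_def[abs_def])
  have norm_T: "norm (T G - \<psi>) = sqrt (infsum g UNIV - sum g G)" if "finite G" for G
  proof -
    have "(\<Sum>\<^sub>\<infinity>k. (norm (h2_coeff (T G - \<psi>) k))\<^sup>2) = infsum g (UNIV - G)"
      by (rule infsum_cong_neutral)
         (use that in \<open>auto simp: coeff_minus T_def coeff_sum_single g_def\<close>)
    also have "\<dots> = infsum g UNIV - infsum g G"
      by (rule infsum_Diff[OF g summable_on_finite[OF that]]) simp
    finally show ?thesis using that by (simp add: norm_H2_def)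
  qed
  have "((\<lambda>G. sqrt (infsum g UNIV - sum g G)) \<longlongrightarrow> sqrt (infsum g UNIV - infsum g UNIV))
      (finite_subsets_at_top UNIV)"
    by (intro tendsto_intros infsum_tendsto g)
  then have "((\<lambda>G. norm (T G - \<psi>)) \<longlongrightarrow> sqrt (infsum g UNIV - infsum g UNIV))
      (finite_subsets_at_top UNIV)"
    by (rule Lim_transform_eventually)
       (simp add: norm_T eventually_finite_subsets_at_top_weakI)
  then have "(T \<longlongrightarrow> \<psi>) (finite_subsets_at_top UNIV)"
    using LIM_zero_cancel[OF tendsto_norm_zero_cancel, of T \<psi>] by simp
  then show ?thesis by (simp add: has_sum_def T_def[abs_def])
qed

section \<open>The dual of the series space\<close>

lemma dual_comp_single:
  assumes "f \<in> dual_space"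
  shows "(\<lambda>v. f (h2_single k v)) \<in> dual_space"
  using assms dual_bound[OF assms, of "h2_single k _"]
  by (intro dual_spaceI[where K = "onorm f"])
     (auto simp: single_add single_scaleC dual_linear_simps norm_single)

lemma dual_comp_coeff:
  assumes "f \<in> dual_space"
  shows "(\<lambda>\<psi> :: ('b::complex_normed_vector, 'd::finite) H2. f (h2_coeff \<psi> k)) \<in> dual_space"
    and "onorm (\<lambda>\<psi> :: ('b, 'd) H2. f (h2_coeff \<psi> k)) \<le> onorm f"
proof -
  have le: "cmod (f (h2_coeff \<psi> k)) \<le> onorm f * norm \<psi>" for \<psi> :: "('b, 'd) H2"
    using dual_bound[OF assms, of "h2_coeff \<psi> k"] norm_coeff_le[of \<psi> k]
      onorm_pos_le[OF bounded_linear_dual[OF assms]]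
    by (meson mult_left_mono order_trans)
  then show "(\<lambda>\<psi> :: ('b, 'd) H2. f (h2_coeff \<psi> k)) \<in> dual_space"
    using assms by (intro dual_spaceI[where K = "onorm f"]) (auto simp: coeff_simps dual_linear_simps)
  show "onorm (\<lambda>\<psi> :: ('b, 'd) H2. f (h2_coeff \<psi> k)) \<le> onorm f"
    using onorm_pos_le[OF bounded_linear_dual[OF assms]] le by (rule onorm_bound)
qed

text \<open>The operator norm need not be attained, so a factor 2 is given away; any factor above 1
  would serve.\<close>

lemma dual_almost_norming:
  assumes f: "f \<in> dual_space"
  shows "\<exists>v r. norm v \<le> 1 \<and> f v = complex_of_real r \<and> onorm f \<le> 2 * r"
proof (cases "onorm f = 0")
  case True
  then show ?thesis using f by (intro exI[of _ 0]) (simp add: dual_linear_simps)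
next
  case False
  then have pos: "onorm f > 0"
    using onorm_pos_le[OF bounded_linear_dual[OF f]] by simp
  have "\<not> (\<forall>x. cmod (f x) \<le> onorm f / 2 * norm x)"
  proof
    assume "\<forall>x. cmod (f x) \<le> onorm f / 2 * norm x"
    then have "onorm f \<le> onorm f / 2" using pos by (intro onorm_bound) auto
    with pos show False by simp
  qed
  then obtain x where x: "onorm f / 2 * norm x < cmod (f x)" by (auto simp: not_le)
  then have "x \<noteq> 0" using f by (auto simp: dual_linear_simps)
  obtain c where c: "cmod c = 1" "c * f x = complex_of_real (cmod (f x))"
    using ex_unit_rotation by blast
  define v where "v = (c / complex_of_real (norm x)) *\<^sub>C x"
  have "norm v \<le> 1" using c(1) \<open>x \<noteq> 0\<close> by (simp add: v_def norm_scaleC norm_divide)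
  moreover have "f v = complex_of_real (cmod (f x) / norm x)"
    using c(2) f by (simp add: v_def dual_linear_simps)
  moreover have "onorm f \<le> 2 * (cmod (f x) / norm x)"
    using x \<open>x \<noteq> 0\<close> by (simp add: field_simps)
  ultimately show ?thesis by blast
qed

lemma le_if_square_le:
  fixes a c :: real
  assumes "0 \<le> a" "0 \<le> c" "a * a \<le> c * a"
  shows "a \<le> c"
  using assms by (cases "a = 0") auto

text \<open>Duality in \<open>\<ell>2\<close>: testing \<open>F\<close> on the finite sum of
  monomials with coefficients \<open>a k\<close> times almost norming vectors bounds the sum of the
  \<open>a k * a k\<close> by \<open>2 * onorm F\<close> times its own square root.\<close>

lemma sq_summable_onorm_single:
  fixes F :: "('b::complex_normed_vector, 'd::finite) H2 \<Rightarrow> complex"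
  assumes F: "F \<in> dual_space"
  shows "sq_summable (\<lambda>k. onorm (\<lambda>v. F (h2_single k v)))"
proof -
  define a where "a k = onorm (\<lambda>v. F (h2_single k v))" for k
  have a: "0 \<le> a k" for k
    unfolding a_def by (intro onorm_pos_le bounded_linear_dual dual_comp_single F)
  have "\<exists>v r. norm v \<le> 1 \<and> F (h2_single k v) = complex_of_real r \<and> a k \<le> 2 * r" for k
    unfolding a_def by (rule dual_almost_norming[OF dual_comp_single[OF F]])
  then obtain v r where v: "\<And>k. norm (v k) \<le> 1"
      "\<And>k. F (h2_single k (v k)) = complex_of_real (r k)" "\<And>k. a k \<le> 2 * r k"
    by metis
  have "L2_set (\<lambda>k. norm (a k)) G \<le> 2 * onorm F" if G: "finite G" for G
  proof (rule le_if_square_le)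
    let ?A = "L2_set (\<lambda>k. norm (a k)) G"
    let ?\<psi> = "\<Sum>k\<in>G. h2_single k (complex_of_real (a k) *\<^sub>C v k)"
    have "?A * ?A = (\<Sum>k\<in>G. a k * a k)"
      by (simp add: L2_set_def sum_nonneg power2_eq_square)
    also have "\<dots> \<le> (\<Sum>k\<in>G. 2 * (a k * r k))"
      using mult_left_mono[OF v(3) a] by (intro sum_mono) (simp add: algebra_simps)
    also have "\<dots> = 2 * (\<Sum>k\<in>G. a k * r k)"
      by (simp add: sum_distrib_left)
    also have "\<dots> \<le> 2 * cmod (F ?\<psi>)"
    proof -
      have "F ?\<psi> = complex_of_real (\<Sum>k\<in>G. a k * r k)"
        using F v(2) by (simp add: dual_linear_simps single_scaleC)
      then show ?thesis by (simp only: norm_of_real)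
    qed
    also have "cmod (F ?\<psi>) \<le> onorm F * norm ?\<psi>" by (rule dual_bound[OF F])
    also have "norm ?\<psi> \<le> ?A"
      unfolding norm_sum_single[OF G]
      using v(1) a by (intro L2_set_mono) (auto simp: norm_scaleC mult_left_le)
    finally show "?A * ?A \<le> 2 * onorm F * ?A"
      using onorm_pos_le[OF bounded_linear_dual[OF F]] by (simp add: mult_left_mono)
  qed (simp_all add: onorm_pos_le[OF bounded_linear_dual[OF F]])
  from sq_summableI(1)[OF this] show ?thesis unfolding a_def .
qed

text \<open>By Cauchy-Schwarz, the part of \<open>F\<close> outside \<open>G\<close> has norm at
  most the \<open>\<ell>2\<close> tail of the norms \<open>a k\<close>, which is small for large
  \<open>G\<close>.\<close>

lemma dual_H2_tail:
  fixes F :: "('b::complex_normed_vector, 'd::finite) H2 \<Rightarrow> complex"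
  assumes F: "F \<in> dual_space" and e: "0 < e"
  shows "\<exists>G. finite G \<and>
    (\<forall>\<psi>. cmod (F \<psi> - (\<Sum>k\<in>G. F (h2_single k (h2_coeff \<psi> k)))) \<le> e * norm \<psi>)"
proof -
  define a where "a k = onorm (\<lambda>v. F (h2_single k v))" for k
  have a: "0 \<le> a k" for k
    unfolding a_def by (intro onorm_pos_le bounded_linear_dual dual_comp_single F)
  define S where "S = (\<Sum>\<^sub>\<infinity>k. (a k)\<^sup>2)"
  have summ: "(\<lambda>k. (a k)\<^sup>2) summable_on UNIV"
    using sq_summable_onorm_single[OF F] by (simp add: sq_summable_def a_def)
  have "\<forall>\<^sub>F G in finite_subsets_at_top UNIV. (\<Sum>k\<in>G. (a k)\<^sup>2) > S - e\<^sup>2"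
    using e infsum_tendsto[OF summ] unfolding S_def by (intro order_tendstoD(1)) auto
  then obtain G where G: "finite G" "(\<Sum>k\<in>G. (a k)\<^sup>2) > S - e\<^sup>2"
    unfolding eventually_finite_subsets_at_top by auto
  have "cmod (F \<psi> - (\<Sum>k\<in>G. F (h2_single k (h2_coeff \<psi> k)))) \<le> e * norm \<psi>" for \<psi>
  proof -
    define h where "h k = F (h2_single k (h2_coeff \<psi> k))" for k
    have "(h has_sum F \<psi>) UNIV"
      using has_sum_bounded_linear[OF bounded_linear_dual[OF F] has_sum_single[of \<psi>]]
      by (simp add: h_def[abs_def] o_def)
    then have lim: "((\<lambda>H. cmod (sum h H - sum h G)) \<longlongrightarrow> cmod (F \<psi> - sum h G)) (finite_subsets_at_top UNIV)"
      unfolding has_sum_def by (intro tendsto_intros)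
    \<comment> \<open>The estimate is made for finite \<open>H\<close> containing \<open>G\<close>,
      uniformly in \<open>H\<close>, and then passed to the limit.\<close>
    have bound: "cmod (sum h H - sum h G) \<le> e * norm \<psi>" if H: "finite H" "G \<subseteq> H" for H
    proof -
      have "sum h H - sum h G = sum h (H - G)" using H by (simp add: sum_diff)
      also have "cmod \<dots> \<le> (\<Sum>k\<in>H - G. cmod (h k))" by (rule norm_sum)
      also have "\<dots> \<le> (\<Sum>k\<in>H - G. \<bar>a k\<bar> * \<bar>norm (h2_coeff \<psi> k)\<bar>)"
        unfolding h_def using a dual_bound[OF dual_comp_single[OF F]]
        by (intro sum_mono) (simp add: a_def)
      also have "\<dots> \<le> L2_set a (H - G) * L2_set (\<lambda>k. norm (h2_coeff \<psi> k)) (H - G)"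
        by (rule L2_set_mult_ineq)
      also have "\<dots> \<le> e * norm \<psi>"
      proof (rule mult_mono)
        have "(\<Sum>k\<in>H - G. (a k)\<^sup>2) = (\<Sum>k\<in>H. (a k)\<^sup>2) - (\<Sum>k\<in>G. (a k)\<^sup>2)"
          using H by (simp add: sum_diff)
        also have "(\<Sum>k\<in>H. (a k)\<^sup>2) \<le> S"
          unfolding S_def using summ H by (intro finite_sum_le_infsum) auto
        finally have "(\<Sum>k\<in>H - G. (a k)\<^sup>2) \<le> e\<^sup>2" using G(2) by simp
        then show "L2_set a (H - G) \<le> e"
          unfolding L2_set_def using e by (intro real_le_lsqrt) (auto intro: sum_nonneg)
      qed (use e H in \<open>auto intro: L2_set_coeff_le\<close>)
      finally show ?thesis .
    qed
    show ?thesis unfolding h_def[symmetric]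
    proof (rule tendsto_upperbound[OF lim])
      show "\<forall>\<^sub>F H in finite_subsets_at_top UNIV. cmod (sum h H - sum h G) \<le> e * norm \<psi>"
        unfolding eventually_finite_subsets_at_top using G(1) bound by auto
    qed simp
  qed
  with G(1) show ?thesis by blast
qed

section \<open>The bidual and reflexivity of the series space\<close>

lemma bidual_add:
  "\<Phi> \<in> bidual_space \<Longrightarrow> f \<in> dual_space \<Longrightarrow> g \<in> dual_space \<Longrightarrow> \<Phi> (\<lambda>x. f x + g x) = \<Phi> f + \<Phi> g"
  by (simp add: bidual_space_def)

lemma bidual_mult: "\<Phi> \<in> bidual_space \<Longrightarrow> f \<in> dual_space \<Longrightarrow> \<Phi> (\<lambda>x. c * f x) = c * \<Phi> f"
  by (simp add: bidual_space_def)

lemma bidual_diff: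
  assumes "\<Phi> \<in> bidual_space" "f \<in> dual_space" "g \<in> dual_space"
  shows "\<Phi> (\<lambda>x. f x - g x) = \<Phi> f - \<Phi> g"
  using bidual_add[OF assms(1,2) dual_mult[OF assms(3), of "-1"]]
    bidual_mult[OF assms(1,3), of "-1"] by simp

lemma bidual_sum:
  assumes \<Phi>: "\<Phi> \<in> bidual_space" and f: "\<And>i. i \<in> A \<Longrightarrow> f i \<in> dual_space"
  shows "\<Phi> (\<lambda>x. \<Sum>i\<in>A. f i x) = (\<Sum>i\<in>A. \<Phi> (f i))"
proof -
  have "\<Phi> (\<lambda>x. 0) = 0" using bidual_mult[OF \<Phi> dual_zero, of 0] by simp
  with f show ?thesis
    by (induction A rule: infinite_finite_induct)
       (simp_all add: bidual_add[OF \<Phi>] dual_sum)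
qed

lemma bidual_bound:
  assumes "\<Phi> \<in> bidual_space"
  obtains K where "0 \<le> K" "\<And>f. f \<in> dual_space \<Longrightarrow> cmod (\<Phi> f) \<le> K * onorm f"
proof -
  obtain K where K: "\<And>f. f \<in> dual_space \<Longrightarrow> cmod (\<Phi> f) \<le> K * onorm f"
    using assms unfolding bidual_space_def by blast
  have "cmod (\<Phi> f) \<le> \<bar>K\<bar> * onorm f" if "f \<in> dual_space" for f
    using K[OF that] mult_right_mono[OF abs_ge_self onorm_pos_le[OF bounded_linear_dual[OF that]], of K]
    by linarith
  then show thesis by (intro that[of "\<bar>K\<bar>"]) auto
qed

text \<open>An element of the bidual is represented coefficientwise by reflexivity of the coefficient
  space. Testing it on combinations of norming functionals bounds the coefficients in
  \<open>\<ell>\<^sup>2\<close>, and functionals of finitely many coefficients are norm dense in the dual.\<close>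

lemma reflexive_space_H2:
  assumes refl: "reflexive_space TYPE('b::complex_normed_vector)"
  shows "reflexive_space TYPE(('b, 'd::finite) H2)"
  unfolding reflexive_space_def
proof
  fix \<Psi> :: "(('b, 'd) H2 \<Rightarrow> complex) \<Rightarrow> complex" assume \<Psi>: "\<Psi> \<in> bidual_space"
  obtain K where K: "0 \<le> K" "\<And>f. f \<in> dual_space \<Longrightarrow> cmod (\<Psi> f) \<le> K * onorm f"
    using bidual_bound[OF \<Psi>] by blast
  \<comment> \<open>Restricted to functionals of the \<open>k\<close>-th coefficient,
    \<open>\<Psi>\<close> is an element of the bidual of the coefficient space.\<close>
  have "\<exists>x. \<forall>f\<in>dual_space. \<Psi> (\<lambda>\<psi>. f (h2_coeff \<psi> k)) = f x" for k
  proof -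
    have "cmod (\<Psi> (\<lambda>\<psi>. f (h2_coeff \<psi> k))) \<le> K * onorm f" if "f \<in> dual_space" for f
      using K(2)[OF dual_comp_coeff(1)[OF that]] mult_left_mono[OF dual_comp_coeff(2)[OF that] K(1)]
      by (rule order_trans)
    then have "(\<lambda>f. \<Psi> (\<lambda>\<psi>. f (h2_coeff \<psi> k))) \<in> bidual_space"
      unfolding bidual_space_def
      by (auto intro!: exI[of _ K] bidual_add[OF \<Psi>] bidual_mult[OF \<Psi>] dual_comp_coeff(1))
    with refl[unfolded reflexive_space_def] show ?thesis by (rule bspec)
  qed
  then obtain x where x: "\<And>k f. f \<in> dual_space \<Longrightarrow> \<Psi> (\<lambda>\<psi>. f (h2_coeff \<psi> k)) = f (x k)"
    by metis
  obtain g where g: "\<And>k. g k \<in> dual_space" "\<And>k. g k (x k) = complex_of_real (norm (x k))"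
      "\<And>k v. cmod (g k v) \<le> norm v"
    using ex_norming_functional[of "x _"] by metis
  have "L2_set (\<lambda>k. norm (x k)) G \<le> K" if G: "finite G" for G
  proof (rule le_if_square_le)
    let ?A = "L2_set (\<lambda>k. norm (x k)) G"
    \<comment> \<open>The test functional weights the norming functionals by
      \<open>norm (x k)\<close>: then \<open>\<Psi> f\<close> equals \<open>?A * ?A\<close>, while
      Cauchy-Schwarz gives \<open>onorm f \<le> ?A\<close>.\<close>
    define f where "f \<psi> = (\<Sum>k\<in>G. complex_of_real (norm (x k)) * g k (h2_coeff \<psi> k))" for \<psi> :: "('b, 'd) H2"
    have summand: "(\<lambda>\<psi>. complex_of_real (norm (x k)) * g k (h2_coeff \<psi> k)) \<in> dual_space" for k
      by (intro dual_mult dual_comp_coeff(1) g(1))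
    have f: "f \<in> dual_space" unfolding f_def[abs_def] by (intro dual_sum summand)
    have "\<Psi> f = (\<Sum>k\<in>G. complex_of_real (norm (x k)) * g k (x k))"
      unfolding f_def[abs_def] bidual_sum[OF \<Psi> summand]
      by (simp add: bidual_mult[OF \<Psi>] dual_comp_coeff(1) g(1) x)
    also have "\<dots> = complex_of_real (\<Sum>k\<in>G. norm (x k) * norm (x k))"
      by (simp add: g(2))
    also have "(\<Sum>k\<in>G. norm (x k) * norm (x k)) = ?A * ?A"
      by (simp add: L2_set_def sum_nonneg power2_eq_square)
    finally have "?A * ?A = cmod (\<Psi> f)" by (simp add: norm_mult)
    also have "\<dots> \<le> K * onorm f" by (rule K(2)[OF f])
    also have "onorm f \<le> ?A"
    proof (rule onorm_bound)
      fix \<psi> :: "('b, 'd) H2"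
      have "cmod (f \<psi>) \<le> (\<Sum>k\<in>G. \<bar>norm (x k)\<bar> * \<bar>norm (h2_coeff \<psi> k)\<bar>)"
        unfolding f_def using g(3)
        by (intro order_trans[OF norm_sum] sum_mono) (simp add: norm_mult mult_left_mono)
      also have "\<dots> \<le> ?A * L2_set (\<lambda>k. norm (h2_coeff \<psi> k)) G" by (rule L2_set_mult_ineq)
      also have "\<dots> \<le> ?A * norm \<psi>" by (intro mult_left_mono L2_set_coeff_le[OF G]) simp
      finally show "cmod (f \<psi>) \<le> ?A * norm \<psi>" .
    qed simp
    finally show "?A * ?A \<le> K * ?A" using K(1) by (simp add: mult_left_mono)
  qed (simp_all add: K(1))
  from sq_summableI(1)[OF this] have coeff_x: "h2_coeff (Abs_H2 x) = x" by (rule coeff_Abs_H2)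
  have "\<Psi> F = F (Abs_H2 x)" if F: "F \<in> dual_space" for F
  proof -
    let ?\<phi> = "Abs_H2 x :: ('b, 'd) H2"
    \<comment> \<open>Replacing \<open>F\<close> by its finite part \<open>H\<close> costs
      \<open>K * e\<close> under \<open>\<Psi>\<close> and \<open>e * norm ?\<phi>\<close> at the
      point; on \<open>H\<close> itself the representation is exact.\<close>
    have le: "cmod (\<Psi> F - F ?\<phi>) \<le> e * (K + norm ?\<phi>)" if e: "0 < e" for e
    proof -
      obtain G where G: "finite G"
          "\<And>\<psi>. cmod (F \<psi> - (\<Sum>k\<in>G. F (h2_single k (h2_coeff \<psi> k)))) \<le> e * norm \<psi>"
        using dual_H2_tail[OF F e] by blast
      define H where "H \<psi> = (\<Sum>k\<in>G. F (h2_single k (h2_coeff \<psi> k)))" for \<psi>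
      have summand: "(\<lambda>\<psi>. F (h2_single k (h2_coeff \<psi> k))) \<in> dual_space" for k
        by (rule dual_comp_coeff(1)[OF dual_comp_single[OF F]])
      have H: "H \<in> dual_space" unfolding H_def[abs_def] by (intro dual_sum summand)
      have "\<Psi> H = H ?\<phi>"
        unfolding H_def[abs_def] bidual_sum[OF \<Psi> summand]
        by (simp add: x[OF dual_comp_single[OF F]] coeff_x)
      moreover have "cmod (\<Psi> F - \<Psi> H) \<le> K * e"
      proof -
        have FH: "(\<lambda>\<psi>. F \<psi> - H \<psi>) \<in> dual_space"
          using dual_add[OF F dual_mult[OF H, of "-1"]] by simp
        have "cmod (\<Psi> F - \<Psi> H) \<le> K * onorm (\<lambda>\<psi>. F \<psi> - H \<psi>)"
          using K(2)[OF FH] by (simp add: bidual_diff[OF \<Psi> F H])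
        also have "onorm (\<lambda>\<psi>. F \<psi> - H \<psi>) \<le> e"
          using e G(2) by (intro onorm_bound) (auto simp: H_def)
        finally show ?thesis using K(1) by (simp add: mult_left_mono)
      qed
      moreover have "cmod (H ?\<phi> - F ?\<phi>) \<le> e * norm ?\<phi>"
        using G(2)[of ?\<phi>] by (simp add: H_def norm_minus_commute)
      ultimately show ?thesis
        using norm_triangle_ineq[of "\<Psi> F - \<Psi> H" "H ?\<phi> - F ?\<phi>"] by (simp add: algebra_simps)
    qed
    have "((\<lambda>e. e * (K + norm ?\<phi>)) \<longlongrightarrow> 0 * (K + norm ?\<phi>)) (at_right 0)"
      by (intro tendsto_intros)
    then have "cmod (\<Psi> F - F ?\<phi>) \<le> 0 * (K + norm ?\<phi>)"
      by (rule tendsto_lowerbound) (auto simp: eventually_at_filter le)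
    then show ?thesis by simp
  qed
  then show "\<exists>\<phi>. \<forall>F\<in>dual_space. \<Psi> F = F \<phi>" by (intro exI[of _ "Abs_H2 x"] ballI)
qed

theorem proposition4p5:
  fixes R :: "'b::complex_banach ring"
  assumes "normed_comm_ring R"
    and "closure (carrier R) = UNIV"
    and "separable_space (euclidean :: 'b topology)"
    and "reflexive_space TYPE('b)"
  shows "locally_seq_weakly_compact TYPE(('b, 'd::finite) H2)"
proof -
  obtain S :: "('b \<Rightarrow> complex) set" where S: "S \<subseteq> dual_space" "countable S"
    and sep: "\<And>x. \<forall>f\<in>S. f x = 0 \<Longrightarrow> x = 0"
    using ex_countable_separating_functionals[OF assms(3)] by blast
  \<comment> \<open>Functionals from \<open>S\<close> applied to single coefficients: countably
    many, as there are countably many multi-indices, and separating because they separate every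
    coefficient.\<close>
  define T where "T = (\<lambda>(f, k) (\<psi> :: ('b, 'd) H2). f (h2_coeff \<psi> k)) ` (S \<times> UNIV)"
  show ?thesis
  proof (rule reflexive_imp_locally_seq_weakly_compact)
    show "reflexive_space TYPE(('b, 'd) H2)" by (rule reflexive_space_H2[OF assms(4)])
    show "countable T" using S(2) by (simp add: T_def)
    show "T \<subseteq> dual_space" using S(1) by (auto simp: T_def intro: dual_comp_coeff(1))
    show "\<psi> = 0" if "\<forall>f\<in>T. f \<psi> = 0" for \<psi>
      using that by (intro H2_eqI) (auto simp: T_def coeff_zero intro!: sep)
  qed
qed

end
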